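(* Let $G$ be a graph that is $(P_4\cup K_1, C_4)$-free and not perfect. Then $G$ is connected and there exists a partition $(V_1,V_2,V_3)$ of $V(G)$ (parts possibly empty) such that (i) $G[V_1]$ is $P_4$-free, and (ii) $V_2$ and $V_3$ are cliques of $G$.
   Context: All graphs are finite, simple and undirected. $P_n$, $C_n$, $K_n$ denote the path, cycle and complete graph on $n$ vertices; $G_1\cup G_2$ denotes the disjoint union of two graphs. For a family $\mathcal F$ of graphs, $G$ is $\mathcal F$-free if no induced subgraph of $G$ is isomorphic to a member of $\mathcal F$. For $S\subseteq V(G)$, $G[S]$ is the subgraph induced by $S$. A graph $G$ is perfect if $\chi(H)=\omega(H)$ for every induced subgraph $H$ of $G$, where $\chi$ is the chromatic number and $\omega$ the clique number. *)

theory Defs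
  imports Main
begin

definition graph :: "'a set \<Rightarrow> ('a \<Rightarrow> 'a \<Rightarrow> bool) \<Rightarrow> bool" where
  "graph V E \<longleftrightarrow> finite V \<and> (\<forall>x y. E x y \<longrightarrow> x \<in> V \<and> y \<in> V)
     \<and> (\<forall>x y. E x y \<longrightarrow> E y x) \<and> (\<forall>x. \<not> E x x)"

definition induced_edges :: "('a \<Rightarrow> 'a \<Rightarrow> bool) \<Rightarrow> 'a set \<Rightarrow> 'a \<Rightarrow> 'a \<Rightarrow> bool" where
  "induced_edges E S = (\<lambda>x y. E x y \<and> x \<in> S \<and> y \<in> S)"

definition graph_iso :: "'a set \<Rightarrow> ('a \<Rightarrow> 'a \<Rightarrow> bool) \<Rightarrow> 'b set \<Rightarrow> ('b \<Rightarrow> 'b \<Rightarrow> bool) \<Rightarrow> bool" where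
  "graph_iso V E W F \<longleftrightarrow> (\<exists>f. bij_betw f V W \<and> (\<forall>x\<in>V. \<forall>y\<in>V. E x y \<longleftrightarrow> F (f x) (f y)))"

definition induced_free :: "'a set \<Rightarrow> ('a \<Rightarrow> 'a \<Rightarrow> bool) \<Rightarrow> 'b set \<Rightarrow> ('b \<Rightarrow> 'b \<Rightarrow> bool) \<Rightarrow> bool" where
  "induced_free V E W F \<longleftrightarrow> \<not> (\<exists>S. S \<subseteq> V \<and> graph_iso S (induced_edges E S) W F)"

definition P4_V :: "nat set" where "P4_V = {0..<4}"
definition P4_E :: "nat \<Rightarrow> nat \<Rightarrow> bool" where
  "P4_E x y \<longleftrightarrow> x < 4 \<and> y < 4 \<and> (x = y + 1 \<or> y = x + 1)"

definition P4K1_V :: "nat set" where "P4K1_V = {0..<5}"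
definition P4K1_E :: "nat \<Rightarrow> nat \<Rightarrow> bool" where
  "P4K1_E x y \<longleftrightarrow> x < 4 \<and> y < 4 \<and> (x = y + 1 \<or> y = x + 1)"

definition C4_V :: "nat set" where "C4_V = {0..<4}"
definition C4_E :: "nat \<Rightarrow> nat \<Rightarrow> bool" where
  "C4_E x y \<longleftrightarrow> x < 4 \<and> y < 4 \<and> ((x + 1) mod 4 = y \<or> (y + 1) mod 4 = x)"

definition is_clique :: "'a set \<Rightarrow> ('a \<Rightarrow> 'a \<Rightarrow> bool) \<Rightarrow> 'a set \<Rightarrow> bool" where
  "is_clique V E S \<longleftrightarrow> S \<subseteq> V \<and> (\<forall>x\<in>S. \<forall>y\<in>S. x \<noteq> y \<longrightarrow> E x y)"

definition clique_number :: "'a set \<Rightarrow> ('a \<Rightarrow> 'a \<Rightarrow> bool) \<Rightarrow> nat" where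
  "clique_number V E = Max (card ` {S. is_clique V E S})"

definition is_colouring :: "'a set \<Rightarrow> ('a \<Rightarrow> 'a \<Rightarrow> bool) \<Rightarrow> nat \<Rightarrow> ('a \<Rightarrow> nat) \<Rightarrow> bool" where
  "is_colouring V E k c \<longleftrightarrow> (\<forall>x\<in>V. c x < k) \<and> (\<forall>x\<in>V. \<forall>y\<in>V. E x y \<longrightarrow> c x \<noteq> c y)"

definition chromatic_number :: "'a set \<Rightarrow> ('a \<Rightarrow> 'a \<Rightarrow> bool) \<Rightarrow> nat" where
  "chromatic_number V E = (LEAST k. \<exists>c. is_colouring V E k c)"

definition perfect :: "'a set \<Rightarrow> ('a \<Rightarrow> 'a \<Rightarrow> bool) \<Rightarrow> bool" where
  "perfect V E \<longleftrightarrow> (\<forall>S. S \<subseteq> V \<longrightarrow>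
     chromatic_number S (induced_edges E S) = clique_number S (induced_edges E S))"

definition connected_graph :: "'a set \<Rightarrow> ('a \<Rightarrow> 'a \<Rightarrow> bool) \<Rightarrow> bool" where
  "connected_graph V E \<longleftrightarrow> V \<noteq> {} \<and>
     (\<forall>x\<in>V. \<forall>y\<in>V. (induced_edges E V)\<^sup>*\<^sup>* x y)"

end

theory Submission
  imports Defs
begin

text \<open>A graph in the class without an induced \<open>C\<^sub>5\<close> is coloured optimally by induction. If it has an
  induced \<open>C\<^sub>6\<close>, then three alternate vertices of that cycle form a stable set that meets all maximum
  cliques. Otherwise it has a simplicial vertex. So an imperfect graph in the class contains an
  induced \<open>C\<^sub>5\<close>. Every vertex sees all of this cycle, three consecutive vertices or two consecutive
  vertices; in particular the cycle is dominating, which gives connectedness. The types that see at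
  least three vertices are cliques, and so few pairs of types can be neither complete nor
  anticomplete to each other that the types can be grouped into the three required parts.\<close>

section \<open>Closed adjacency\<close>

text \<open>The relation \<open>R\<close> stands for ``equal or adjacent''. The vertices of an induced path or cycle
  listed below are then automatically distinct, and a vertex of a cycle is treated like any
  other vertex with the same neighbours.\<close>

locale P4K1_C4_free =
  fixes V :: "'a set" and R :: "'a \<Rightarrow> 'a \<Rightarrow> bool"
  assumes fin: "finite V"
    and R_refl [simp]: "R x x"
    and R_sym: "R x y \<Longrightarrow> R y x"
    and no_P4K1: "\<lbrakk>R a b; R b c; R c d; \<not> R a c; \<not> R a d; \<not> R b d; e \<in> V;
      \<not> R e a; \<not> R e b; \<not> R e c; \<not> R e d\<rbrakk> \<Longrightarrow> False"
    and no_C4: "\<lbrakk>R a b; R b c; R c d; R d a; \<not> R a c; \<not> R b d\<rbrakk> \<Longrightarrow> False"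
begin

lemma R_commute: "R x y \<longleftrightarrow> R y x"
  using R_sym by blast

definition clique :: "'a set \<Rightarrow> bool" where
  "clique K \<longleftrightarrow> (\<forall>x\<in>K. \<forall>y\<in>K. R x y)"

definition P4_free :: "'a set \<Rightarrow> bool" where
  "P4_free S \<longleftrightarrow> (\<forall>a\<in>S. \<forall>b\<in>S. \<forall>c\<in>S. \<forall>d\<in>S. R a b \<longrightarrow> R b c \<longrightarrow> R c d \<longrightarrow>
     R a c \<or> R a d \<or> R b d)"

definition complete_to :: "'a set \<Rightarrow> 'a set \<Rightarrow> bool" where
  "complete_to X Y \<longleftrightarrow> (\<forall>x\<in>X. \<forall>y\<in>Y. R x y)"

definition anticomplete_to :: "'a set \<Rightarrow> 'a set \<Rightarrow> bool" where
  "anticomplete_to X Y \<longleftrightarrow> (\<forall>x\<in>X. \<forall>y\<in>Y. \<not> R x y)"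

definition C5 :: "'a \<Rightarrow> 'a \<Rightarrow> 'a \<Rightarrow> 'a \<Rightarrow> 'a \<Rightarrow> bool" where
  "C5 a b c d e \<longleftrightarrow> a \<in> V \<and> b \<in> V \<and> c \<in> V \<and> d \<in> V \<and> e \<in> V \<and>
     R a b \<and> R b c \<and> R c d \<and> R d e \<and> R e a \<and>
     \<not> R a c \<and> \<not> R b d \<and> \<not> R c e \<and> \<not> R d a \<and> \<not> R e b"

text \<open>Where the six vertices lie is left to each use: the induction in
  \<open>exists_simplicial\<close> needs them in the current set \<open>S\<close>, not merely in
  \<open>V\<close>.\<close>

definition C6 :: "'a \<Rightarrow> 'a \<Rightarrow> 'a \<Rightarrow> 'a \<Rightarrow> 'a \<Rightarrow> 'a \<Rightarrow> bool" where
  "C6 a b c d e f \<longleftrightarrow>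
     R a b \<and> R b c \<and> R c d \<and> R d e \<and> R e f \<and> R f a \<and>
     \<not> R a c \<and> \<not> R b d \<and> \<not> R c e \<and> \<not> R d f \<and> \<not> R e a \<and> \<not> R f b \<and>
     \<not> R a d \<and> \<not> R b e \<and> \<not> R c f"

section \<open>Closure properties of cliques and P4-free sets\<close>

lemma clique_mono: "clique K \<Longrightarrow> L \<subseteq> K \<Longrightarrow> clique L"
  by (auto simp: clique_def)

lemma clique_P4_free: "clique K \<Longrightarrow> P4_free K"
  by (auto simp: clique_def P4_free_def)

lemma complete_to_commute: "complete_to X Y \<longleftrightarrow> complete_to Y X"
  unfolding complete_to_def using R_sym by blast

lemma clique_Un: "clique X \<Longrightarrow> clique Y \<Longrightarrow> complete_to X Y \<Longrightarrow> clique (X \<union> Y)"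
  unfolding clique_def complete_to_def by (metis R_sym Un_iff)

text \<open>The complement of P4 is connected, so an induced P4 of a join lies on one side.\<close>

lemma P4_free_join:
  assumes "P4_free X" "P4_free Y" "complete_to X Y"
  shows "P4_free (X \<union> Y)"
  unfolding P4_free_def
proof (intro ballI impI)
  fix a b c d
  assume "a \<in> X \<union> Y" "b \<in> X \<union> Y" "c \<in> X \<union> Y" "d \<in> X \<union> Y" "R a b" "R b c" "R c d"
  then show "R a c \<or> R a d \<or> R b d"
    using assms R_sym unfolding P4_free_def complete_to_def by (elim UnE) meson+
qed

text \<open>P4 is connected, so an induced P4 cannot meet both of two anticomplete sets.\<close>

lemma P4_free_disjoint_union:
  assumes "P4_free X" "P4_free Y" "anticomplete_to X Y"
  shows "P4_free (X \<union> Y)"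
  unfolding P4_free_def
proof (intro ballI impI)
  fix a b c d
  assume "a \<in> X \<union> Y" "b \<in> X \<union> Y" "c \<in> X \<union> Y" "d \<in> X \<union> Y" "R a b" "R b c" "R c d"
  then show "R a c \<or> R a d \<or> R b d"
    using assms R_sym unfolding P4_free_def anticomplete_to_def by (elim UnE) meson+
qed

section \<open>Graphs without an induced five-cycle\<close>

text \<open>Choose non-adjacent \<open>v\<close>, \<open>u\<close> such that \<open>C = N[u] - N[v]\<close> is as large as possible. Then \<open>C\<close> is a
  component of the non-neighbourhood of \<open>v\<close>, its neighbourhood \<open>T\<close> is a clique, and by maximality
  all remaining vertices \<open>W\<close> are complete to \<open>T\<close>, so a simplicial vertex of \<open>W\<close> is simplicial in
  the whole graph.\<close>

lemma exists_simplicial: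
  assumes noC5: "\<And>a b c d e. \<not> C5 a b c d e"
    and "S \<subseteq> V" "S \<noteq> {}"
    and "\<And>a b c d e f. {a,b,c,d,e,f} \<subseteq> S \<Longrightarrow> \<not> C6 a b c d e f"
  shows "\<exists>v\<in>S. clique {x\<in>S. R v x}"
  using assms(2-)
proof (induction "card S" arbitrary: S rule: less_induct)
  case less
  note SV = less.prems(1) and noC6 = less.prems(3)
  have finS: "finite S" using fin SV finite_subset by blast
  show ?case
  proof (cases "\<exists>v\<in>S. \<exists>u\<in>S. \<not> R v u")
    case False
    then show ?thesis using less.prems(2) by (auto simp: clique_def)
  next
    case True
    define C where "C = (\<lambda>(v, u). {x\<in>S. R u x \<and> \<not> R v x})"
    define P where "P = {(v, u). v \<in> S \<and> u \<in> S \<and> \<not> R v u}"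
    have "P \<subseteq> S \<times> S" by (auto simp: P_def)
    then have finP: "finite P" using finS finite_subset by blast
    have "P \<noteq> {}" using True by (auto simp: P_def)
    then have "Max ((\<lambda>q. card (C q)) ` P) \<in> (\<lambda>q. card (C q)) ` P"
      using finP by (intro Max_in) auto
    then obtain q where q: "q \<in> P" "Max ((\<lambda>q. card (C q)) ` P) = card (C q)"
      by auto
    have q_max: "card (C q') \<le> card (C q)" if "q' \<in> P" for q'
      unfolding q(2)[symmetric] using finP that by (intro Max_ge) auto
    obtain v u where quv: "q = (v, u)" by force
    have v: "v \<in> S" and u: "u \<in> S" and vu: "\<not> R v u" using q(1) quv by (auto simp: P_def)
    have finC: "finite (C p)" for p using finS by (cases p) (auto simp: C_def)
    \<comment> \<open>For a pair \<open>p\<close> attaining the maximum, \<open>C p\<close> is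
      closed under adjacency among the non-neighbours of \<open>w\<close>. This is used for
      \<open>(v, u)\<close> and, further below, for a second maximum pair.\<close>
    have component: False
      if "p = (w, u')" "p \<in> P" "card (C p) = card (C q)" "c \<in> C p" "t \<in> S" "\<not> R w t" "t \<notin> C p" "R c t"
      for p w u' c t
    proof -
      have c: "c \<in> S" "R u' c" "\<not> R w c" using that by (auto simp: C_def)
      have t: "\<not> R u' t" using that by (auto simp: C_def)
      \<comment> \<open>Passing from \<open>u'\<close> to \<open>c\<close> gains \<open>t\<close>,
        so by maximality it must lose some neighbour \<open>r\<close> of \<open>u'\<close>.\<close>
      have "(w, c) \<in> P" using that c by (auto simp: P_def)
      then have "card (C (w, c)) \<le> card (C p)" using q_max that by metis
      moreover have "t \<in> C (w, c)" using that by (auto simp: C_def)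
      ultimately have "\<not> C p \<subseteq> C (w, c)"
        using that(7) finC[of "(w,c)"] by (metis card_subset_eq card_mono le_antisym)
      then have "\<not> C (w, u') \<subseteq> C (w, c)" using that(1) by simp
      then obtain r where r: "r \<in> S" "R u' r" "\<not> R w r" "\<not> R c r"
        by (auto simp: C_def)
      have w: "w \<in> V" "\<not> R w u'" using that SV by (auto simp: P_def)
      show False
      \<comment> \<open>\<open>r\<close>, \<open>u'\<close>, \<open>c\<close>, \<open>t\<close> span
        a four-cycle, or an induced path that \<open>w\<close> misses.\<close>
      proof (cases "R r t")
        case True
        then show False using no_C4[of r u' c t] r c t that R_sym by metis
      next
        case False
        then show False using no_P4K1[of r u' c t w] r c t w that R_sym by metis
      qed
    qed
    define T where "T = {s\<in>S. R v s \<and> (\<exists>c\<in>C q. R c s)}"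
    define W where "W = S - (C q \<union> T)"
    have uC: "u \<in> C q" using quv u vu by (auto simp: C_def)
    have cC: "R u c \<and> \<not> R v c \<and> c \<in> S" if "c \<in> C q" for c using that quv by (auto simp: C_def)
    have T: "clique T"
      unfolding clique_def
    proof (intro ballI, rule ccontr)
      fix p p' assume T: "p \<in> T" "p' \<in> T" and n: "\<not> R p p'"
      then obtain c c' where c: "c \<in> C q" "R c p" "c' \<in> C q" "R c' p'"
        by (auto simp: T_def)
      have p: "R v p" "R v p'" "p \<in> S" "p' \<in> S" using T by (auto simp: T_def)
      have h: "\<not> (R p x \<and> R p' x)" if "\<not> R v x" for x
        using no_C4[of v p x p'] that p n R_sym by metis
      have h5: "\<not> R x x'" if "\<not> R v x" "\<not> R v x'" "R p x" "R p' x'" "x \<in> S" "x' \<in> S" for x x'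
      proof
        assume "R x x'"
        then have "C5 v p x x' p'"
          using that h p n SV v R_sym unfolding C5_def by (metis subsetD)
        then show False using noC5 by blast
      qed
      \<comment> \<open>Both \<open>c\<close> and \<open>c'\<close> see \<open>u\<close>, so any of
        these three adjacencies would close a five-cycle through \<open>v\<close>, \<open>p\<close>,
        \<open>p'\<close>. Without them the six-cycle is induced.\<close>
      have "\<not> R c c'" "\<not> R u p" "\<not> R u p'"
        using h5[of c c'] h5[of c u] h5[of u c'] c cC R_sym u vu by blast+
      then have "C6 v p c u c' p'"
        using p c cC R_sym n h vu unfolding C6_def by metis
      then show False using noC6[of v p c u c' p'] p c cC u v by blast
    qed
    have WC: "\<not> R w c" if "w \<in> W" "c \<in> C q" for w c
    proof (cases "R v w")
      case True
      then show ?thesis using that R_sym unfolding W_def T_def by blast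
    next
      case False
      then show ?thesis using component[OF quv q(1) refl that(2), of w] that R_sym unfolding W_def by blast
    qed
    have WT: "R w s" if w: "w \<in> W" and s: "s \<in> T" for w s
    proof (rule ccontr)
      assume ws: "\<not> R w s"
      have wu: "(w, u) \<in> P" using WC[OF w uC] w u by (auto simp: P_def W_def)
      \<comment> \<open>Since \<open>w\<close> misses \<open>C q\<close>, the pair
        \<open>(w, u)\<close> is again maximum with the same component. By \<open>component\<close>,
        \<open>s\<close> cannot be adjacent to that component and yet miss \<open>w\<close>.\<close>
      have "c \<in> C (w, u)" if "c \<in> C q" for c
        using WC[OF w that] cC[OF that] by (simp add: C_def)
      then have "C q \<subseteq> C (w, u)" by blast
      then have eq: "C (w, u) = C q" using q_max[OF wu] finC card_seteq by metis
      obtain c where c: "c \<in> C q" "R c s" using s by (auto simp: T_def)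
      have "s \<notin> C q" "s \<in> S" using s cC unfolding T_def by blast+
      then show False using component[OF refl wu _ _ _ ws, of c] eq c by metis
    qed
    have "W \<subset> S"
      using uC u by (auto simp: W_def)
    have "v \<in> W"
      using v cC R_sym R_refl unfolding W_def T_def by blast
    obtain w where w: "w \<in> W" "clique {x\<in>W. R w x}"
    proof -
      have "\<exists>w\<in>W. clique {x\<in>W. R w x}"
      proof (rule less.hyps)
        show "card W < card S" using \<open>W \<subset> S\<close> finS psubset_card_mono by blast
        show "W \<subseteq> V" "W \<noteq> {}" using \<open>W \<subset> S\<close> \<open>v \<in> W\<close> SV by auto
        show "\<not> C6 a b c d e f" if "{a,b,c,d,e,f} \<subseteq> W" for a b c d e f
          using that \<open>W \<subset> S\<close> by (intro noC6) blast
      qed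
      then show ?thesis using that by blast
    qed
    have "x \<in> W \<union> T" if "x \<in> S" "R w x" for x
      using WC that \<open>w \<in> W\<close> by (auto simp: W_def)
    then have "{x\<in>S. R w x} \<subseteq> {x\<in>W. R w x} \<union> T" by blast
    moreover have "complete_to {x\<in>W. R w x} T" using WT by (auto simp: complete_to_def)
    ultimately have "clique {x\<in>S. R w x}"
      using clique_Un[OF w(2) T] clique_mono by blast
    then show ?thesis using \<open>w \<in> W\<close> \<open>W \<subset> S\<close> by blast
  qed
qed

text \<open>Hence a clique that avoids \<open>a\<close>, \<open>c\<close> and \<open>e\<close> is not maximum.\<close>

lemma C6_clique_extends:
  assumes noC5: "\<And>a b c d e. \<not> C5 a b c d e"
    and cyc: "C6 a b c d e f" "{a,b,c,d,e,f} \<subseteq> V"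
    and K: "K \<subseteq> V" "clique K"
  shows "\<exists>v\<in>{a,c,e}. \<forall>x\<in>K. R v x"
proof (rule ccontr)
  have adj: "R a b" "R b c" "R c d" "R d e" "R e f" "R f a"
    and nadj: "\<not> R a c" "\<not> R b d" "\<not> R c e" "\<not> R d f" "\<not> R e a" "\<not> R f b" "\<not> R a d" "\<not> R b e" "\<not> R c f"
    using cyc(1) unfolding C6_def by blast+
  have adj': "R b a" "R c b" "R d c" "R e d" "R f e" "R a f"
    using adj R_sym by blast+
  have nadj': "\<not> R c a" "\<not> R d b" "\<not> R e c" "\<not> R f d" "\<not> R a e" "\<not> R b f"
    "\<not> R d a" "\<not> R e b" "\<not> R f c"
    using nadj R_sym by blast+
  have between: "R x z" if "R x y" "R x y'" "R y z" "R z y'" "\<not> R y y'" for x y y' z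
    using no_C4[of x y z y'] that R_sym by metis
  have opposite: "R x q" if "x \<in> V" "p \<in> V" "q \<in> V" "r \<in> V" "s \<in> V" "R x p" "R x s"
      "R p q" "R q r" "R r s" "\<not> R p r" "\<not> R q s" "\<not> R p s" for x p q r s
  \<comment> \<open>If \<open>x\<close> missed \<open>q\<close>, it would miss \<open>r\<close> by
    \<open>between\<close>, which leaves the induced five-cycle \<open>x\<close>, \<open>p\<close>,
    \<open>q\<close>, \<open>r\<close>, \<open>s\<close>.\<close>
  proof (rule ccontr)
    assume "\<not> R x q"
    moreover have "\<not> R x r" using between[of x p r q] calculation that by blast
    ultimately have "C5 x p q r s" using that R_sym unfolding C5_def by metis
    then show False using noC5 by blast
  qed
  \<comment> \<open>A vertex sees all of the six-cycle or exactly three consecutive vertices. In the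
    first disjunct, \<open>a\<close>, \<open>c\<close>, \<open>e\<close> force the other three by
    \<open>between\<close>.\<close>
  have types: "(R x a \<and> R x c \<and> R x e) \<or>
      (R x a \<and> R x b \<and> R x c \<and> \<not> R x d \<and> \<not> R x e \<and> \<not> R x f) \<or>
      (R x b \<and> R x c \<and> R x d \<and> \<not> R x e \<and> \<not> R x f \<and> \<not> R x a) \<or>
      (R x c \<and> R x d \<and> R x e \<and> \<not> R x f \<and> \<not> R x a \<and> \<not> R x b) \<or>
      (R x d \<and> R x e \<and> R x f \<and> \<not> R x a \<and> \<not> R x b \<and> \<not> R x c) \<or>
      (R x e \<and> R x f \<and> R x a \<and> \<not> R x b \<and> \<not> R x c \<and> \<not> R x d) \<or>
      (R x f \<and> R x a \<and> R x b \<and> \<not> R x c \<and> \<not> R x d \<and> \<not> R x e)" if x: "x \<in> V" for x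
  proof -
    have "R x a \<Longrightarrow> R x c \<Longrightarrow> R x b" "R x b \<Longrightarrow> R x d \<Longrightarrow> R x c" "R x c \<Longrightarrow> R x e \<Longrightarrow> R x d"
      "R x d \<Longrightarrow> R x f \<Longrightarrow> R x e" "R x e \<Longrightarrow> R x a \<Longrightarrow> R x f" "R x f \<Longrightarrow> R x b \<Longrightarrow> R x a"
      using between adj nadj by blast+
    moreover have "R x a \<Longrightarrow> R x d \<Longrightarrow> R x b" "R x b \<Longrightarrow> R x e \<Longrightarrow> R x c" "R x c \<Longrightarrow> R x f \<Longrightarrow> R x d"
      "R x d \<Longrightarrow> R x a \<Longrightarrow> R x e" "R x e \<Longrightarrow> R x b \<Longrightarrow> R x f" "R x f \<Longrightarrow> R x c \<Longrightarrow> R x a"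
      using opposite[of x a b c d] opposite[of x b c d e] opposite[of x c d e f]
        opposite[of x d e f a] opposite[of x e f a b] opposite[of x f a b c]
        adj nadj nadj' cyc(2) x by simp_all
    moreover have "R x a \<or> R x b \<or> R x c \<or> R x d" "R x b \<or> R x c \<or> R x d \<or> R x e"
      "R x c \<or> R x d \<or> R x e \<or> R x f" "R x d \<or> R x e \<or> R x f \<or> R x a"
      "R x e \<or> R x f \<or> R x a \<or> R x b" "R x f \<or> R x a \<or> R x b \<or> R x c"
      using no_P4K1[of a b c d x] no_P4K1[of b c d e x] no_P4K1[of c d e f x]
        no_P4K1[of d e f a x] no_P4K1[of e f a b x] no_P4K1[of f a b c x]
        adj nadj nadj' x by blast+
    ultimately show ?thesis by argo
  qed
  have opposite_types: "R u q \<or> R v p" if "R u v" "R u p" "R v q" "R p q" for u v p q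
    using no_C4[of u v q p] that R_sym by metis
  have distance_two: "R u q \<or> R u r \<or> R v p \<or> R v q"
    if "R u v" "u \<in> V" "v \<in> V" "p \<in> V" "q \<in> V" "r \<in> V" "R p q" "R q r" "\<not> R p r" "R u p" "R v r"
    for u v p q r
  proof (rule ccontr)
    assume "\<not> ?thesis"
    then have "C5 u v r q p" using that R_sym unfolding C5_def by metis
    then show False using noC5 by blast
  qed
  assume contr: "\<not> (\<exists>v\<in>{a,c,e}. \<forall>x\<in>K. R v x)"
  obtain x where x: "x \<in> K" "\<not> R x a" using contr R_sym by (metis insertI1)
  obtain y where y: "y \<in> K" "\<not> R y c" using contr R_sym by (metis insertI1 insertI2)
  obtain z where z: "z \<in> K" "\<not> R z e" using contr R_sym by (metis insertI1 insertI2)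
  have V: "x \<in> V" "y \<in> V" "z \<in> V" using x y z K by auto
  have xyz: "R x y" "R y x" "R x z" "R z x" "R y z" "R z y" using x y z K(2) by (auto simp: clique_def)
  \<comment> \<open>The vertices \<open>x\<close>, \<open>y\<close>, \<open>z\<close> each see one
    of the three consecutive triples that avoid \<open>a\<close>, \<open>c\<close>,
    \<open>e\<close>, respectively.\<close>
  have X: "R x d \<and> R x c \<and> R x b \<and> \<not> R x e \<and> \<not> R x f \<or> R x c \<and> R x d \<and> R x e \<and> \<not> R x f \<and> \<not> R x b \<or>
      R x d \<and> R x e \<and> R x f \<and> \<not> R x b \<and> \<not> R x c"
    using types[OF V(1)] x(2) by argo
  have Y: "R y f \<and> R y e \<and> R y d \<and> \<not> R y a \<and> \<not> R y b \<or> R y e \<and> R y f \<and> R y a \<and> \<not> R y b \<and> \<not> R y d \<or>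
      R y f \<and> R y a \<and> R y b \<and> \<not> R y d \<and> \<not> R y e"
    using types[OF V(2)] y(2) by argo
  have Z: "R z b \<and> R z a \<and> R z f \<and> \<not> R z c \<and> \<not> R z d \<or> R z a \<and> R z b \<and> R z c \<and> \<not> R z d \<and> \<not> R z f \<or>
      R z b \<and> R z c \<and> R z d \<and> \<not> R z f \<and> \<not> R z a"
    using types[OF V(3)] z(2) by argo
  \<comment> \<open>Adjacency within \<open>K\<close> restricts the triples: together the next facts
    leave \<open>c\<close>, \<open>d\<close>, \<open>e\<close> for \<open>x\<close> and
    \<open>e\<close>, \<open>f\<close>, \<open>a\<close> for \<open>y\<close>. Then
    \<open>x\<close>, \<open>y\<close>, \<open>a\<close>, \<open>b\<close>, \<open>c\<close> form an
    induced five-cycle.\<close>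
  have "R x e \<and> R y e"
    using distance_two[OF xyz(1) V(1,2), of d e f] distance_two[OF xyz(1) V(1,2), of b a f]
      distance_two[OF xyz(1) V(1,2), of d c b] opposite_types[OF xyz(1), of b a]
      opposite_types[OF xyz(1), of c b] cyc(2) adj adj' nadj nadj' X Y x(2) y(2) by auto
  moreover have "R y a"
    using distance_two[OF xyz(5) V(2,3), of f a b] distance_two[OF xyz(5) V(2,3), of d c b]
      opposite_types[OF xyz(5), of d c] cyc(2) adj adj' nadj nadj' Y Z y(2) z(2) by auto
  moreover have "R x c"
    using distance_two[OF xyz(4) V(3,1), of b c d] distance_two[OF xyz(4) V(3,1), of b a f]
      opposite_types[OF xyz(4), of b a] opposite_types[OF xyz(4), of a f] cyc(2) adj adj' nadj nadj' Z X z(2) x(2) by auto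
  ultimately show False
    using distance_two[OF xyz(1) V(1,2), of c b a] x y cyc(2) adj adj' nadj nadj' X Y x(2) y(2) by auto
qed

section \<open>Optimal colouring by induction\<close>

definition colourable :: "'a set \<Rightarrow> nat \<Rightarrow> bool" where
  "colourable S k \<longleftrightarrow>
     (\<exists>c. (\<forall>x\<in>S. c x < k) \<and> (\<forall>x\<in>S. \<forall>y\<in>S. R x y \<and> x \<noteq> y \<longrightarrow> c x \<noteq> (c y :: nat)))"

lemma colourableI:
  assumes "\<And>x. x \<in> S \<Longrightarrow> c x < k"
    and "\<And>x y. x \<in> S \<Longrightarrow> y \<in> S \<Longrightarrow> R x y \<Longrightarrow> x \<noteq> y \<Longrightarrow> c x \<noteq> c y"
  shows "colourable S k"
  using assms unfolding colourable_def by blast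

lemma colourableE:
  assumes "colourable S k"
  obtains c where "\<And>x. x \<in> S \<Longrightarrow> c x < k"
    and "\<And>x y. x \<in> S \<Longrightarrow> y \<in> S \<Longrightarrow> R x y \<Longrightarrow> x \<noteq> y \<Longrightarrow> c x \<noteq> c y"
  using assms unfolding colourable_def by blast

text \<open>The bound \<open>k\<close> varies in the induction: a stable set that meets all cliques
  of size \<open>k\<close> takes one colour and lowers the bound by one, while deleting a simplicial
  vertex keeps it.\<close>

lemma colourable_of_C5_free:
  assumes noC5: "\<And>a b c d e. \<not> C5 a b c d e"
    and "S \<subseteq> V" "\<And>K. K \<subseteq> S \<Longrightarrow> clique K \<Longrightarrow> card K \<le> k"
  shows "colourable S k"
  using assms(2-)
proof (induction "card S" arbitrary: S k rule: less_induct)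
  case less
  note SV = less.prems(1) and cliques = less.prems(2)
  have finS: "finite S" using fin SV finite_subset by blast
  consider "S = {}" | (cycle) a b c d e f where "{a,b,c,d,e,f} \<subseteq> S" "C6 a b c d e f"
    | (simplicial) v where "v \<in> S" "clique {x\<in>S. R v x}"
  proof (cases "S = {} \<or> (\<exists>a b c d e f. {a,b,c,d,e,f} \<subseteq> S \<and> C6 a b c d e f)")
    case True
    then show ?thesis using that(1,2) by metis
  next
    case False
    have "\<exists>v\<in>S. clique {x\<in>S. R v x}"
    proof (rule exists_simplicial[OF noC5 SV])
      show "S \<noteq> {}" using False by simp
      show "\<not> C6 a b c d e f" if "{a,b,c,d,e,f} \<subseteq> S" for a b c d e f
        using False that by metis
    qed
    then show ?thesis using that(3) by metis
  qed
  then show ?case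
  proof cases
    case 1
    then show ?thesis by (simp add: colourable_def)
  next
    case cycle
    define I where "I = {a, c, e}"
    have stable: "\<not> R x y" if "x \<in> I" "y \<in> I" "x \<noteq> y" for x y
      using cycle(2) that by (auto simp: I_def C6_def R_commute)
    have "k \<noteq> 0"
      using cliques[of "{a}"] cycle(1) by (auto simp: clique_def)
    then obtain k' where k: "k = Suc k'" using not0_implies_Suc by blast
    have "colourable (S - I) k'"
    proof (rule less.hyps)
      show "card (S - I) < card S"
        using cycle(1) finS by (intro psubset_card_mono) (auto simp: I_def)
      show "S - I \<subseteq> V" using SV by blast
      fix K assume K: "K \<subseteq> S - I" "clique K"
      \<comment> \<open>\<open>v\<close> lies outside \<open>K\<close> and extends it to a clique of
        \<open>S\<close>, so \<open>K\<close> has fewer than \<open>k\<close> vertices.\<close>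
      obtain v where v: "v \<in> I" "\<forall>x\<in>K. R v x"
        using C6_clique_extends[OF noC5 cycle(2), of K] K cycle(1) SV unfolding I_def by blast
      have "clique {v}" "complete_to {v} K" using v by (auto simp: clique_def complete_to_def)
      then have "clique ({v} \<union> K)" using K clique_Un by blast
      moreover have "{v} \<union> K \<subseteq> S" using v K cycle(1) by (auto simp: I_def)
      ultimately have "card ({v} \<union> K) \<le> k" using cliques by blast
      moreover have "v \<notin> K" "finite K" using v K finS finite_subset by blast+
      ultimately show "card K \<le> k'" using k by simp
    qed
    then obtain g where g: "\<And>x. x \<in> S - I \<Longrightarrow> g x < k'"
      "\<And>x y. x \<in> S - I \<Longrightarrow> y \<in> S - I \<Longrightarrow> R x y \<Longrightarrow> x \<noteq> y \<Longrightarrow> g x \<noteq> g y"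
      by (rule colourableE) blast
    show ?thesis
    proof (rule colourableI)
      fix x assume "x \<in> S"
      then show "(if x \<in> I then k' else g x) < k"
        using g(1)[of x] k by (cases "x \<in> I") simp_all
    next
      fix x y assume "x \<in> S" "y \<in> S" "R x y" "x \<noteq> y"
      then show "(if x \<in> I then k' else g x) \<noteq> (if y \<in> I then k' else g y)"
        using g(1)[of x] g(1)[of y] g(2)[of x y] stable[of x y]
        by (cases "x \<in> I"; cases "y \<in> I") simp_all
    qed
  next
    case simplicial
    let ?N = "{x\<in>S - {v}. R v x}"
    have "colourable (S - {v}) k"
    proof (rule less.hyps)
      show "card (S - {v}) < card S" using finS simplicial(1) by (rule card_Diff1_less)
      show "S - {v} \<subseteq> V" using SV by blast
      show "card K \<le> k" if "K \<subseteq> S - {v}" "clique K" for K using that by (intro cliques) auto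
    qed
    then obtain g where g: "\<And>x. x \<in> S - {v} \<Longrightarrow> g x < k"
      "\<And>x y. x \<in> S - {v} \<Longrightarrow> y \<in> S - {v} \<Longrightarrow> R x y \<Longrightarrow> x \<noteq> y \<Longrightarrow> g x \<noteq> g y"
      by (rule colourableE) blast
    \<comment> \<open>\<open>v\<close> and its neighbours form a clique, so the neighbours use fewer
      than \<open>k\<close> colours and some colour \<open>i\<close> is free for
      \<open>v\<close>.\<close>
    have "card {x\<in>S. R v x} \<le> k" using simplicial(2) by (intro cliques) auto
    moreover have "{x\<in>S. R v x} = insert v ?N" using simplicial(1) by auto
    ultimately have "card ?N < k" using finS by simp
    then have less: "card (g ` ?N) < card {..<k}"
      using card_image_le[of ?N g] finS by simp
    have "\<not> {..<k} \<subseteq> g ` ?N"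
      using card_mono[of "g ` ?N" "{..<k}"] finS less by auto
    then obtain i where i: "i < k" "i \<notin> g ` ?N" by blast
    have new: "g y \<noteq> i" if "y \<in> S" "y \<noteq> v" "R v y" for y
      using i(2) that by blast
    show ?thesis
    proof (rule colourableI)
      show "(g(v := i)) x < k" if "x \<in> S" for x using g(1)[of x] i that by simp
    next
      fix x y assume xy: "x \<in> S" "y \<in> S" "R x y" "x \<noteq> y"
      then have "R y x" using R_sym by blast
      then show "(g(v := i)) x \<noteq> (g(v := i)) y"
        using g(2)[of x y] new[of x] new[of y] xy by (cases "x = v"; cases "y = v") simp_all
    qed
  qed
qed

section \<open>The neighbourhood types of an induced five-cycle\<close>

text \<open>The first argument is the position on the cycle: \<open>opposite a b c d e\<close> sees only the edge
  \<open>c d\<close> opposite to \<open>a\<close>. The results below are stated for one position; the others are instances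
  under rotation and reflection of the arguments.\<close>

definition centres :: "'a \<Rightarrow> 'a \<Rightarrow> 'a \<Rightarrow> 'a \<Rightarrow> 'a \<Rightarrow> 'a set" where
  "centres a b c d e = {x\<in>V. R x a \<and> R x b \<and> R x c \<and> R x d \<and> R x e}"

definition twins :: "'a \<Rightarrow> 'a \<Rightarrow> 'a \<Rightarrow> 'a \<Rightarrow> 'a \<Rightarrow> 'a set" where
  "twins a b c d e = {x\<in>V. R x e \<and> R x a \<and> R x b \<and> \<not> R x c \<and> \<not> R x d}"

definition opposite :: "'a \<Rightarrow> 'a \<Rightarrow> 'a \<Rightarrow> 'a \<Rightarrow> 'a \<Rightarrow> 'a set" where
  "opposite a b c d e = {x\<in>V. R x c \<and> R x d \<and> \<not> R x e \<and> \<not> R x a \<and> \<not> R x b}"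

lemma C5_rotate: "C5 a b c d e \<Longrightarrow> C5 b c d e a"
  by (auto simp: C5_def)

lemma C5_reflect: "C5 a b c d e \<Longrightarrow> C5 a e d c b"
  by (auto simp: C5_def R_commute)

lemma reflect: "twins a e d c b = twins a b c d e" "opposite a e d c b = opposite a b c d e"
  by (auto simp: twins_def opposite_def)

text \<open>Two neighbours at distance two on the cycle force the vertex between them (no C4), and
  any four consecutive vertices contain a neighbour (no P4 with an isolated vertex). The cycle
  vertices count as their own twins.\<close>

lemma C5_types:
  assumes cyc: "C5 a b c d e"
  shows "V = centres a b c d e
     \<union> (twins a b c d e \<union> twins b c d e a \<union> twins c d e a b \<union> twins d e a b c \<union> twins e a b c d)
     \<union> (opposite a b c d e \<union> opposite b c d e a \<union> opposite c d e a b \<union> opposite d e a b c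
        \<union> opposite e a b c d)"
proof -
  have adj: "R a b" "R b c" "R c d" "R d e" "R e a"
    and nadj: "\<not> R a c" "\<not> R b d" "\<not> R c e" "\<not> R d a" "\<not> R e b"
    using cyc unfolding C5_def by blast+
  have nadj': "\<not> R c a" "\<not> R d b" "\<not> R e c" "\<not> R a d" "\<not> R b e"
    using nadj R_sym by blast+
  have between: "R x z" if "R x y" "R x y'" "R y z" "R z y'" "\<not> R y y'" for x y y' z
    using no_C4[of x y z y'] that R_sym by metis
  have types: "(R x a \<and> R x b \<and> R x c \<and> R x d \<and> R x e) \<or>
      (R x a \<and> R x b \<and> R x c \<and> \<not> R x d \<and> \<not> R x e) \<or>
      (R x b \<and> R x c \<and> R x d \<and> \<not> R x e \<and> \<not> R x a) \<or>
      (R x c \<and> R x d \<and> R x e \<and> \<not> R x a \<and> \<not> R x b) \<or>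
      (R x d \<and> R x e \<and> R x a \<and> \<not> R x b \<and> \<not> R x c) \<or>
      (R x e \<and> R x a \<and> R x b \<and> \<not> R x c \<and> \<not> R x d) \<or>
      (R x a \<and> R x b \<and> \<not> R x c \<and> \<not> R x d \<and> \<not> R x e) \<or>
      (R x b \<and> R x c \<and> \<not> R x d \<and> \<not> R x e \<and> \<not> R x a) \<or>
      (R x c \<and> R x d \<and> \<not> R x e \<and> \<not> R x a \<and> \<not> R x b) \<or>
      (R x d \<and> R x e \<and> \<not> R x a \<and> \<not> R x b \<and> \<not> R x c) \<or>
      (R x e \<and> R x a \<and> \<not> R x b \<and> \<not> R x c \<and> \<not> R x d)" if x: "x \<in> V" for x
  proof -
    have "R x a \<Longrightarrow> R x c \<Longrightarrow> R x b" "R x b \<Longrightarrow> R x d \<Longrightarrow> R x c" "R x c \<Longrightarrow> R x e \<Longrightarrow> R x d"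
      "R x d \<Longrightarrow> R x a \<Longrightarrow> R x e" "R x e \<Longrightarrow> R x b \<Longrightarrow> R x a"
      using between adj nadj by blast+
    moreover have "R x a \<or> R x b \<or> R x c \<or> R x d" "R x b \<or> R x c \<or> R x d \<or> R x e"
      "R x c \<or> R x d \<or> R x e \<or> R x a" "R x d \<or> R x e \<or> R x a \<or> R x b"
      "R x e \<or> R x a \<or> R x b \<or> R x c"
      using no_P4K1[of a b c d x] no_P4K1[of b c d e x] no_P4K1[of c d e a x]
        no_P4K1[of d e a b x] no_P4K1[of e a b c x] adj nadj nadj' x by blast+
    ultimately show ?thesis by argo
  qed
  show ?thesis (is "V = ?U")
  proof (intro equalityI subsetI)
    show "x \<in> ?U" if "x \<in> V" for x
      using types[OF that] that by (elim disjE) (simp_all add: centres_def twins_def opposite_def)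
    show "x \<in> V" if "x \<in> ?U" for x
      using that by (simp add: centres_def twins_def opposite_def) argo
  qed
qed

text \<open>All these vertices see the non-adjacent \<open>e\<close> and \<open>b\<close>, so a
  non-adjacent pair would give a C4.\<close>

lemma centres_twins_clique:
  assumes "C5 a b c d e"
  shows "clique (centres a b c d e \<union> twins a b c d e)"
  unfolding clique_def
proof (intro ballI, rule ccontr)
  fix x y assume "x \<in> centres a b c d e \<union> twins a b c d e" "y \<in> centres a b c d e \<union> twins a b c d e" "\<not> R x y"
  then show False
    using no_C4[of x e y b] assms by (auto simp: centres_def twins_def C5_def R_commute)
qed

lemma twins_anticomplete:
  assumes "C5 a b c d e"
  shows "anticomplete_to (twins a b c d e) (twins c d e a b)"
  unfolding anticomplete_to_def
proof (intro ballI notI)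
  fix x y assume "x \<in> twins a b c d e" "y \<in> twins c d e a b" "R x y"
  then show False
    using no_C4[of x y d e] assms by (auto simp: twins_def C5_def R_commute)
qed

lemma opposite_twins_anticomplete:
  assumes "C5 a b c d e"
  shows "anticomplete_to (opposite a b c d e) (twins a b c d e)"
  unfolding anticomplete_to_def
proof (intro ballI notI)
  fix x y assume "x \<in> opposite a b c d e" "y \<in> twins a b c d e" "R x y"
  then show False
    using no_C4[of x y b c] assms by (auto simp: twins_def opposite_def C5_def R_commute)
qed

text \<open>Otherwise \<open>e\<close>, \<open>a\<close>, \<open>b\<close>, \<open>y\<close> is an
  induced path that \<open>x\<close> misses.\<close>

lemma opposite_twins_complete:
  assumes "C5 a b c d e"
  shows "complete_to (opposite a b c d e) (twins c d e a b)"
  unfolding complete_to_def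
proof (intro ballI, rule ccontr)
  fix x y assume "x \<in> opposite a b c d e" "y \<in> twins c d e a b" "\<not> R x y"
  then show False
    using no_P4K1[of e a b y x] assms by (auto simp: twins_def opposite_def C5_def R_commute)
qed

lemma opposite_twins_complete':
  assumes "C5 a b c d e"
  shows "complete_to (opposite a b c d e) (twins d e a b c)"
  using opposite_twins_complete[OF C5_reflect[OF assms]] reflect[of a e d c b] reflect[of d e a b c] by simp

lemma opposite_complete:
  assumes "C5 a b c d e"
  shows "complete_to (opposite a b c d e) (opposite b c d e a)"
  unfolding complete_to_def
proof (intro ballI, rule ccontr)
  fix x y assume "x \<in> opposite a b c d e" "y \<in> opposite b c d e a" "\<not> R x y"
  then show False
    using no_P4K1[of x c b a y] assms by (auto simp: opposite_def C5_def R_commute)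
qed

text \<open>Vertices \<open>x\<close> and \<open>y\<close> of the two types form a C4 with
  \<open>e\<close> and \<open>d\<close> if adjacent; otherwise \<open>b\<close> misses the path
  \<open>x\<close>, \<open>d\<close>, \<open>e\<close>, \<open>y\<close>.\<close>

lemma opposite_distance_two:
  assumes "C5 a b c d e" "opposite a b c d e \<noteq> {}"
  shows "opposite c d e a b = {}"
proof (rule ccontr)
  assume "opposite c d e a b \<noteq> {}"
  then obtain x y where "x \<in> opposite a b c d e" "y \<in> opposite c d e a b"
    using assms(2) by blast
  then show False
    using no_P4K1[of x d e y b] no_C4[of x y e d] assms(1) by (auto simp: opposite_def C5_def R_commute)
qed

text \<open>No vertex of this type sees \<open>a\<close>, so an induced P4 would be missed by
  \<open>a\<close>.\<close>

lemma opposite_P4_free: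
  assumes "C5 a b c d e"
  shows "P4_free (opposite a b c d e)"
  unfolding P4_free_def
proof (intro ballI impI, rule ccontr)
  fix w x y z
  assume "w \<in> opposite a b c d e" "x \<in> opposite a b c d e" "y \<in> opposite a b c d e" "z \<in> opposite a b c d e"
    "R w x" "R x y" "R y z" "\<not> (R w y \<or> R w z \<or> R x z)"
  then show False
    using no_P4K1[of w x y z a] assms by (auto simp: opposite_def C5_def R_commute)
qed

text \<open>A vertex \<open>y\<close> opposite to \<open>a\<close> sees all of the first set. For a
  non-adjacent pair \<open>u\<close>, \<open>w\<close> there is a C4 if \<open>y\<close> sees
  \<open>w\<close>, and otherwise an induced path \<open>y\<close>, \<open>u\<close>,
  \<open>e\<close>, \<open>w\<close> missed by \<open>b\<close>.\<close>

lemma twins_complete_of_opposite: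
  assumes cyc: "C5 a b c d e" and "opposite a b c d e \<noteq> {}"
  shows "complete_to (twins d e a b c) (twins e a b c d)"
  unfolding complete_to_def
proof (intro ballI, rule ccontr)
  fix u w assume u: "u \<in> twins d e a b c" and w: "w \<in> twins e a b c d" and uw: "\<not> R u w"
  obtain y where y: "y \<in> opposite a b c d e" using assms(2) by blast
  have yu: "R y u" using opposite_twins_complete'[OF cyc] y u by (auto simp: complete_to_def)
  show False
  proof (cases "R y w")
    case True
    then show False using no_C4[of y w e u] yu y u w uw by (auto simp: opposite_def twins_def R_commute)
  next
    case False
    then show False
      using no_P4K1[of y u e w b] yu y u w uw cyc by (auto simp: opposite_def twins_def C5_def R_commute)
  qed
qed

lemma twins_complete_of_opposite':
  assumes "C5 a b c d e" "opposite a b c d e \<noteq> {}"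
  shows "complete_to (twins b c d e a) (twins c d e a b)"
  using twins_complete_of_opposite[OF C5_reflect[OF assms(1)]] assms(2)
    reflect[of a e d c b] reflect[of c d e a b] reflect[of b c d e a]
  by (simp add: complete_to_commute)

text \<open>Take a non-adjacent pair \<open>x\<close>, \<open>y\<close> on the left and
  \<open>z\<close>, \<open>w\<close> on the right. The path \<open>x\<close>, \<open>e\<close>,
  \<open>d\<close>, \<open>z\<close> forces \<open>y\<close> to see \<open>z\<close>, and then
  \<open>x\<close> misses the induced path \<open>y\<close>, \<open>z\<close>, \<open>d\<close>,
  \<open>w\<close>.\<close>

lemma twins_complete_or:
  assumes cyc: "C5 a b c d e"
  shows "complete_to (twins a b c d e) (twins b c d e a) \<or> complete_to (twins c d e a b) (twins d e a b c)"
proof (rule ccontr)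
  assume "\<not> ?thesis"
  then obtain x y z w where xy: "x \<in> twins a b c d e" "y \<in> twins b c d e a" "\<not> R x y"
    and zw: "z \<in> twins c d e a b" "w \<in> twins d e a b c" "\<not> R z w"
    unfolding complete_to_def by blast
  have "\<not> R x z" "\<not> R y w" "\<not> R w x"
    using twins_anticomplete[OF cyc] twins_anticomplete[OF C5_rotate[OF cyc]]
      twins_anticomplete[OF C5_rotate[OF C5_rotate[OF C5_rotate[OF cyc]]]] xy zw
    unfolding anticomplete_to_def by blast+
  moreover from this have "R y z"
    using no_P4K1[of x e d z y] xy zw cyc by (auto simp: twins_def C5_def R_commute)
  ultimately show False
    using no_P4K1[of y z d w x] xy zw by (auto simp: twins_def R_commute)
qed

section \<open>The partition\<close>

text \<open>The three sets may overlap; they are made disjoint only at the end by set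
  differences.\<close>

definition splits :: bool where
  "splits \<longleftrightarrow> (\<exists>X Y Z. V = X \<union> Y \<union> Z \<and> P4_free X \<and> clique Y \<and> clique Z)"

lemma centres_rotate: "centres b c d e a = centres a b c d e"
  by (auto simp: centres_def)

lemma twins_clique: "C5 a b c d e \<Longrightarrow> clique (twins a b c d e)"
  using centres_twins_clique by (rule clique_mono) auto

lemma centres_twins_twins_clique:
  assumes "C5 a b c d e" "complete_to (twins a b c d e) (twins b c d e a)"
  shows "clique (centres a b c d e \<union> (twins a b c d e \<union> twins b c d e a))"
proof -
  have "clique (twins a b c d e \<union> centres a b c d e)"
    using centres_twins_clique[OF assms(1)] by (simp add: Un_commute)
  moreover have "clique (centres a b c d e \<union> twins b c d e a)"
    using centres_twins_clique[OF C5_rotate[OF assms(1)]] by (simp add: centres_rotate)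
  ultimately show ?thesis
    using assms(2) unfolding clique_def complete_to_def by (metis R_sym Un_iff)
qed

text \<open>The P4-free part is the join of the type opposite to \<open>a\<close> with the twins of
  \<open>c\<close>, put beside the twins of \<open>a\<close>. The twins of \<open>d\<close> and
  \<open>e\<close> join the centres, and the twins of \<open>b\<close> remain. The type opposite to
  \<open>a\<close> may itself be empty.\<close>

lemma splits_single:
  assumes cyc: "C5 a b c d e"
    and empty: "opposite b c d e a = {}" "opposite c d e a b = {}" "opposite d e a b c = {}" "opposite e a b c d = {}"
    and de: "complete_to (twins d e a b c) (twins e a b c d)"
  shows splits
proof -
  have "P4_free (opposite a b c d e \<union> twins c d e a b)"
    using opposite_P4_free[OF cyc] twins_clique[OF C5_rotate[OF C5_rotate[OF cyc]]] opposite_twins_complete[OF cyc]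
    by (simp add: P4_free_join clique_P4_free)
  moreover have "anticomplete_to (opposite a b c d e \<union> twins c d e a b) (twins a b c d e)"
    using opposite_twins_anticomplete[OF cyc] twins_anticomplete[OF cyc] R_sym
    unfolding anticomplete_to_def by blast
  ultimately have "P4_free (opposite a b c d e \<union> twins c d e a b \<union> twins a b c d e)"
    using twins_clique[OF cyc] by (simp add: P4_free_disjoint_union clique_P4_free)
  moreover have "clique (centres a b c d e \<union> (twins d e a b c \<union> twins e a b c d))"
    using centres_twins_twins_clique[OF C5_rotate[OF C5_rotate[OF C5_rotate[OF cyc]]] de]
    by (simp add: centres_rotate)
  moreover have "clique (twins b c d e a)"
    using twins_clique[OF C5_rotate[OF cyc]] .
  moreover have "V = (opposite a b c d e \<union> twins c d e a b \<union> twins a b c d e)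
      \<union> (centres a b c d e \<union> (twins d e a b c \<union> twins e a b c d)) \<union> twins b c d e a"
    using C5_types[OF cyc] unfolding empty by blast
  ultimately show ?thesis unfolding splits_def by blast
qed

text \<open>The two opposite types and the twins of \<open>d\<close> form a join. Each non-empty
  opposite type makes one pair of consecutive twin sets complete, which yields the two
  cliques.\<close>

lemma splits_double:
  assumes cyc: "C5 a b c d e"
    and nonempty: "opposite a b c d e \<noteq> {}" "opposite b c d e a \<noteq> {}"
    and empty: "opposite c d e a b = {}" "opposite d e a b c = {}" "opposite e a b c d = {}"
  shows splits
proof -
  note cyc1 = C5_rotate[OF cyc]
  note cyc4 = C5_rotate[OF C5_rotate[OF C5_rotate[OF cyc1]]]
  have "P4_free (opposite a b c d e \<union> opposite b c d e a)"
    using opposite_P4_free[OF cyc] opposite_P4_free[OF cyc1] opposite_complete[OF cyc]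
    by (intro P4_free_join)
  moreover have "complete_to (opposite a b c d e \<union> opposite b c d e a) (twins d e a b c)"
    using opposite_twins_complete'[OF cyc] opposite_twins_complete[OF cyc1]
    by (auto simp: complete_to_def)
  ultimately have "P4_free (opposite a b c d e \<union> opposite b c d e a \<union> twins d e a b c)"
    using twins_clique[OF C5_rotate[OF C5_rotate[OF cyc1]]] by (simp add: P4_free_join clique_P4_free)
  moreover have "clique (centres a b c d e \<union> (twins e a b c d \<union> twins a b c d e))"
    using centres_twins_twins_clique[OF cyc4 twins_complete_of_opposite[OF cyc1 nonempty(2)]]
    by (simp add: centres_rotate)
  moreover have "clique (twins b c d e a \<union> twins c d e a b)"
    using twins_clique[OF cyc1] twins_clique[OF C5_rotate[OF cyc1]] twins_complete_of_opposite'[OF cyc nonempty(1)]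
    by (rule clique_Un)
  moreover have "V = (opposite a b c d e \<union> opposite b c d e a \<union> twins d e a b c)
      \<union> (centres a b c d e \<union> (twins e a b c d \<union> twins a b c d e)) \<union> (twins b c d e a \<union> twins c d e a b)"
    using C5_types[OF cyc] unfolding empty by blast
  ultimately show ?thesis unfolding splits_def by blast
qed

text \<open>Non-empty opposite types never sit at distance two on the cycle, so at most two of them
  occur, at consecutive positions.\<close>

lemma splits_opposite:
  assumes cyc: "C5 a b c d e" and a: "opposite a b c d e \<noteq> {}"
  shows splits
proof -
  note cyc1 = C5_rotate[OF cyc]
  note cyc4 = C5_rotate[OF C5_rotate[OF C5_rotate[OF cyc1]]]
  have c: "opposite c d e a b = {}"
    using opposite_distance_two[OF cyc a] .
  have d: "opposite d e a b c = {}"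
    using opposite_distance_two[OF C5_rotate[OF C5_rotate[OF cyc1]]] a by blast
  have be: "opposite b c d e a = {} \<or> opposite e a b c d = {}"
    using opposite_distance_two[OF cyc4] by blast
  show ?thesis
  proof (cases "opposite b c d e a = {}")
    case False
    then show ?thesis using splits_double[OF cyc a _ c d] be by blast
  next
    case b: True
    show ?thesis
    proof (cases "opposite e a b c d = {}")
      case True
      then show ?thesis using splits_single[OF cyc b c d _ twins_complete_of_opposite[OF cyc a]] by blast
    next
      case False
      then show ?thesis using splits_double[OF cyc4 _ a b c d] by blast
    qed
  qed
qed

lemma splits_of_C5:
  assumes cyc: "C5 a b c d e"
  shows splits
proof (cases "opposite a b c d e = {} \<and> opposite b c d e a = {} \<and> opposite c d e a b = {}
    \<and> opposite d e a b c = {} \<and> opposite e a b c d = {}")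
  case True
  then show ?thesis
    \<comment> \<open>The two alternatives are the completeness hypothesis of
      \<open>splits_single\<close> for the cycle started at \<open>c\<close> and at
      \<open>e\<close>.\<close>
    using twins_complete_or[OF cyc] splits_single[OF C5_rotate[OF C5_rotate[OF cyc]]]
      splits_single[OF C5_rotate[OF C5_rotate[OF C5_rotate[OF C5_rotate[OF cyc]]]]] by blast
next
  case False
  note cyc1 = C5_rotate[OF cyc]
  note cyc2 = C5_rotate[OF cyc1]
  note cyc3 = C5_rotate[OF cyc2]
  note cyc4 = C5_rotate[OF cyc3]
  show ?thesis
    using False splits_opposite[OF cyc] splits_opposite[OF cyc1] splits_opposite[OF cyc2]
      splits_opposite[OF cyc3] splits_opposite[OF cyc4] by blast
qed

lemma C5_dominating:
  assumes "C5 a b c d e" "x \<in> V"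
  shows "\<exists>y\<in>{a,b,c,d,e}. R x y"
  using no_P4K1[of a b c d x] assms by (auto simp: C5_def R_commute)

end

section \<open>Translation to the pattern graphs\<close>

lemma induced_free_path_union_vertex:
  assumes G: "graph V E" and "induced_free V E P4K1_V P4K1_E"
    and "E a b" "E b c" "E c d" "\<not> E a c" "\<not> E a d" "\<not> E b d"
    and "e \<in> V" "\<not> E e a" "\<not> E e b" "\<not> E e c" "\<not> E e d"
  shows False
proof -
  have sym: "E x y \<longleftrightarrow> E y x" and irr: "\<not> E x x" for x y
    using G unfolding graph_def by blast+
  have V: "a \<in> V" "b \<in> V" "c \<in> V" "d \<in> V"
    using G assms(3-5) unfolding graph_def by blast+
  \<comment> \<open>Adjacent vertices differ by irreflexivity; any two non-adjacent ones are told
    apart by a third vertex that sees exactly one of them.\<close>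
  have dist: "distinct [a,b,c,d,e]"
    using assms(3-) irr sym by auto
  define f :: "'a \<Rightarrow> nat" where
    "f x = (if x = a then 0 else if x = b then 1 else if x = c then 2 else if x = d then 3 else 4)" for x
  have f: "f a = 0" "f b = 1" "f c = 2" "f d = 3" "f e = 4"
    using dist by (auto simp: f_def)
  have "P4K1_V = {0,1,2,3,4}" by (auto simp: P4K1_V_def)
  then have "bij_betw f {a,b,c,d,e} P4K1_V"
    using dist f by (auto simp: bij_betw_def inj_on_def)
  moreover have "\<forall>x\<in>{a,b,c,d,e}. \<forall>y\<in>{a,b,c,d,e}. induced_edges E {a,b,c,d,e} x y \<longleftrightarrow> P4K1_E (f x) (f y)"
    using assms(3-) f irr sym by (simp add: induced_edges_def P4K1_E_def)
  ultimately have "graph_iso {a,b,c,d,e} (induced_edges E {a,b,c,d,e}) P4K1_V P4K1_E"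
    unfolding graph_iso_def by (intro exI conjI)
  moreover have "{a,b,c,d,e} \<subseteq> V" using assms(9) V by simp
  ultimately show False
    using assms(2) unfolding induced_free_def by metis
qed

text \<open>Opposite vertices must be assumed distinct: walking to and fro along an edge also gives
  four consecutive adjacencies.\<close>

lemma induced_free_four_cycle:
  assumes G: "graph V E" and "induced_free V E C4_V C4_E"
    and "E a b" "E b c" "E c d" "E d a" "a \<noteq> c" "b \<noteq> d" "\<not> E a c" "\<not> E b d"
  shows False
proof -
  have sym: "E x y \<longleftrightarrow> E y x" and irr: "\<not> E x x" for x y
    using G unfolding graph_def by blast+
  have V: "a \<in> V" "b \<in> V" "c \<in> V" "d \<in> V"
    using G assms(3-6) unfolding graph_def by blast+
  have dist: "distinct [a,b,c,d]"
    using assms(3-) irr by auto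
  define f :: "'a \<Rightarrow> nat" where
    "f x = (if x = a then 0 else if x = b then 1 else if x = c then 2 else 3)" for x
  have f: "f a = 0" "f b = 1" "f c = 2" "f d = 3"
    using dist by (auto simp: f_def)
  have "C4_V = {0,1,2,3}" by (auto simp: C4_V_def)
  then have "bij_betw f {a,b,c,d} C4_V"
    using dist f by (auto simp: bij_betw_def inj_on_def)
  moreover have "\<forall>x\<in>{a,b,c,d}. \<forall>y\<in>{a,b,c,d}. induced_edges E {a,b,c,d} x y \<longleftrightarrow> C4_E (f x) (f y)"
    using assms(3-) f irr sym by (simp add: induced_edges_def C4_E_def)
  ultimately have "graph_iso {a,b,c,d} (induced_edges E {a,b,c,d}) C4_V C4_E"
    unfolding graph_iso_def by (intro exI conjI)
  moreover have "{a,b,c,d} \<subseteq> V" using V by simp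
  ultimately show False
    using assms(2) unfolding induced_free_def by metis
qed

lemma induced_free_P4I:
  assumes "\<And>a b c d. {a,b,c,d} \<subseteq> S \<Longrightarrow> E a b \<Longrightarrow> E b c \<Longrightarrow> E c d \<Longrightarrow> distinct [a,b,c,d] \<Longrightarrow>
    E a c \<or> E a d \<or> E b d"
  shows "induced_free S (induced_edges E S) P4_V P4_E"
  unfolding induced_free_def
proof
  assume "\<exists>T\<subseteq>S. graph_iso T (induced_edges (induced_edges E S) T) P4_V P4_E"
  then obtain T f where T: "T \<subseteq> S" and bij: "bij_betw f T P4_V"
    and iso: "\<And>x y. x \<in> T \<Longrightarrow> y \<in> T \<Longrightarrow> induced_edges (induced_edges E S) T x y \<longleftrightarrow> P4_E (f x) (f y)"
    unfolding graph_iso_def by blast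
  \<comment> \<open>The inverse isomorphism lists the vertices of the induced path in order.\<close>
  define g where "g = inv_into T f"
  have g: "g i \<in> T" "f (g i) = i" if "i < 4" for i
  proof -
    have "i \<in> f ` T" using bij that by (simp add: bij_betw_def P4_V_def)
    then show "g i \<in> T" "f (g i) = i"
      unfolding g_def by (simp_all add: inv_into_into f_inv_into_f)
  qed
  have "E (g i) (g j) \<longleftrightarrow> P4_E i j" if "i < 4" "j < 4" for i j
    using iso[of "g i" "g j"] g[OF that(1)] g[OF that(2)] T by (auto simp: induced_edges_def)
  moreover have "g i \<noteq> g j" if "i < 4" "j < 4" "i \<noteq> j" for i j
    using g that by metis
  moreover have "g i \<in> S" if "i < 4" for i
    using g(1) that T by blast
  ultimately show False
    using assms[of "g 0" "g 1" "g 2" "g 3"] by (simp add: P4_E_def)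
qed

section \<open>Clique number and chromatic number\<close>

lemma clique_card_le_clique_number:
  assumes "finite S" "is_clique S F K"
  shows "card K \<le> clique_number S F"
proof -
  have "{K. is_clique S F K} \<subseteq> Pow S" by (auto simp: is_clique_def)
  then have "finite {K. is_clique S F K}" using assms(1) by (meson finite_Pow_iff finite_subset)
  then show ?thesis using assms(2) unfolding clique_number_def by (intro Max_ge) auto
qed

text \<open>A colouring is injective on every clique, so it needs at least as many colours as the
  clique number.\<close>

lemma chromatic_number_eq_clique_number:
  assumes "finite S" "is_colouring S F (clique_number S F) c"
  shows "chromatic_number S F = clique_number S F"
  unfolding chromatic_number_def
proof (rule Least_equality)
  show "\<exists>c. is_colouring S F (clique_number S F) c" using assms(2) by blast
next
  fix k assume "\<exists>c. is_colouring S F k c"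
  then obtain c where c: "is_colouring S F k c" by blast
  have "card K \<le> k" if "is_clique S F K" for K
  proof -
    have "inj_on c K" "c ` K \<subseteq> {..<k}"
      using c that unfolding is_colouring_def is_clique_def inj_on_def by blast+
    then show ?thesis using card_inj_on_le[of c K "{..<k}"] by simp
  qed
  moreover have "{K. is_clique S F K} \<subseteq> Pow S" by (auto simp: is_clique_def)
  then have "finite {K. is_clique S F K}" using assms(1) by (meson finite_Pow_iff finite_subset)
  moreover have "is_clique S F {}" by (simp add: is_clique_def)
  ultimately show "clique_number S F \<le> k"
    unfolding clique_number_def by (subst Max_le_iff) auto
qed

theorem theorem3p1:
  fixes V :: "'a set" and E :: "'a \<Rightarrow> 'a \<Rightarrow> bool"
  assumes "graph V E"
    and "induced_free V E P4K1_V P4K1_E"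
    and "induced_free V E C4_V C4_E"
    and "\<not> perfect V E"
  shows "connected_graph V E \<and>
    (\<exists>V1 V2 V3. V1 \<union> V2 \<union> V3 = V \<and> V1 \<inter> V2 = {} \<and> V1 \<inter> V3 = {} \<and> V2 \<inter> V3 = {}
       \<and> induced_free V1 (induced_edges E V1) P4_V P4_E
       \<and> is_clique V E V2 \<and> is_clique V E V3)"
proof -
  define R where "R x y \<longleftrightarrow> x = y \<or> E x y" for x y
  have sym: "E x y \<Longrightarrow> E y x" and irr: "\<not> E x x" for x y
    using assms(1) unfolding graph_def by blast+
  interpret P4K1_C4_free V R
  proof
    show "finite V" using assms(1) by (simp add: graph_def)
    show "R x x" for x by (simp add: R_def)
    show "R y x" if "R x y" for x y using that sym by (auto simp: R_def)
    show False if "R a b" "R b c" "R c d" "\<not> R a c" "\<not> R a d" "\<not> R b d" "e \<in> V"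
      "\<not> R e a" "\<not> R e b" "\<not> R e c" "\<not> R e d" for a b c d e
      using induced_free_path_union_vertex[OF assms(1,2), of a b c d e] that unfolding R_def by blast
    show False if "R a b" "R b c" "R c d" "R d a" "\<not> R a c" "\<not> R b d" for a b c d
      \<comment> \<open>If consecutive vertices coincided, a required non-adjacency would fail;
        symmetry of \<open>c\<close>, \<open>d\<close> settles the case
        \<open>d = a\<close>.\<close>
      using induced_free_four_cycle[OF assms(1,3), of a b c d] that sym[of c d] unfolding R_def by blast
  qed
  obtain a b c d e where cyc: "C5 a b c d e"
  proof (rule ccontr)
    assume "\<not> thesis"
    then have noC5: "\<not> C5 a b c d e" for a b c d e using that by blast
    have "chromatic_number S (induced_edges E S) = clique_number S (induced_edges E S)" if S: "S \<subseteq> V" for S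
    proof -
      have finS: "finite S" using S fin finite_subset by blast
      have "colourable S (clique_number S (induced_edges E S))"
      proof (rule colourable_of_C5_free[OF noC5 S])
        fix K assume "K \<subseteq> S" "clique K"
        then show "card K \<le> clique_number S (induced_edges E S)"
          using finS by (intro clique_card_le_clique_number)
            (auto simp: is_clique_def clique_def R_def induced_edges_def)
      qed
      then obtain c where c: "\<And>x. x \<in> S \<Longrightarrow> c x < clique_number S (induced_edges E S)"
        "\<And>x y. x \<in> S \<Longrightarrow> y \<in> S \<Longrightarrow> R x y \<Longrightarrow> x \<noteq> y \<Longrightarrow> c x \<noteq> c y"
        by (rule colourableE) blast
      have "c x \<noteq> c y" if "x \<in> S" "y \<in> S" "E x y" for x y
        using c(2)[of x y] that irr by (metis R_def)
      with c(1) have "is_colouring S (induced_edges E S) (clique_number S (induced_edges E S)) c"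
        by (simp add: is_colouring_def induced_edges_def)
      then show ?thesis using chromatic_number_eq_clique_number finS by blast
    qed
    then show False using assms(4) unfolding perfect_def by blast
  qed
  have R_path: "(induced_edges E V)\<^sup>*\<^sup>* x y" if "R x y" for x y
    using that assms(1) by (auto simp: R_def induced_edges_def graph_def)
  \<comment> \<open>Every vertex reaches the dominating five-cycle in one step and then
    \<open>a\<close> along it.\<close>
  have to_a: "R\<^sup>*\<^sup>* x a" if "x \<in> V" for x
  proof -
    have "R b a" "R c b" "R d e" "R e a" using cyc R_sym unfolding C5_def by blast+
    then have "R\<^sup>*\<^sup>* y a" if "y \<in> {a,b,c,d,e}" for y
      using that by (auto intro: converse_rtranclp_into_rtranclp)
    then show ?thesis
      using C5_dominating[OF cyc that] by (meson converse_rtranclp_into_rtranclp)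
  qed
  have "R\<^sup>*\<^sup>* x y" if "x \<in> V" "y \<in> V" for x y
  proof -
    have "symp R\<^sup>*\<^sup>*" using R_sym by (intro symp_rtranclp) (auto intro: sympI)
    then show ?thesis using to_a that by (meson rtranclp_trans sympD)
  qed
  moreover have "(induced_edges E V)\<^sup>*\<^sup>* x y" if "R\<^sup>*\<^sup>* x y" for x y
    using that by induction (auto intro: rtranclp_trans R_path)
  ultimately have "connected_graph V E"
    using cyc unfolding connected_graph_def C5_def by blast
  moreover obtain X Y Z where XYZ: "V = X \<union> Y \<union> Z" "P4_free X" "clique Y" "clique Z"
    using splits_of_C5[OF cyc] unfolding splits_def by blast
  have "induced_free X (induced_edges E X) P4_V P4_E"
  proof (rule induced_free_P4I)
    fix a b c d
    assume "{a,b,c,d} \<subseteq> X" "E a b" "E b c" "E c d" "distinct [a,b,c,d]"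
    then show "E a c \<or> E a d \<or> E b d"
      using XYZ(2) by (simp add: P4_free_def R_def) blast
  qed
  moreover have "is_clique V E (Y - X)" "is_clique V E (Z - (X \<union> Y))"
    using XYZ by (auto simp: is_clique_def clique_def R_def)
  moreover have "X \<union> (Y - X) \<union> (Z - (X \<union> Y)) = V" "X \<inter> (Y - X) = {}" "X \<inter> (Z - (X \<union> Y)) = {}"
    "(Y - X) \<inter> (Z - (X \<union> Y)) = {}"
    using XYZ(1) by blast+
  ultimately show ?thesis by blast
qed

end
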